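(* For every integer $k>2$, the matroid $M_k$ satisfies $\chi_g(M_k)\ge 2k-1$.
   Context: For $k>2$, let $E_k=C\cup D_1\cup\dots\cup D_{3k(2k-1)}$, where $C,D_1,\dots,D_{3k(2k-1)}$ are pairwise disjoint, $|C|=k(2k-1)$ and $|D_i|=k$ for each $i$. $M_k$ is the transversal matroid on $E_k$ of the family of sets consisting of $D_1,\dots,D_{3k(2k-1)}$ together with $2k-1$ copies of $E_k$; i.e. a subset $X\subseteq E_k$ is independent iff its elements can be matched injectively to distinct members of this family (indexed with multiplicity) with each element lying in the member it is matched to. For a loopless matroid $M$, $\chi_g(M)$ is the minimum number of colors for which Alice has a winning strategy in the following game: Alice and Bob alternately (Alice first) color an uncolored element with one of the colors so that at every moment every color class is independent in $M$; Alice wins if the whole ground set is colored, Bob wins if a partial coloring is reached that cannot be extended. *)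

theory Defs
  imports Main "HOL-Library.Disjoint_Sets"
begin

text \<open>A matroid is given by its ground set and its independence predicate.\<close>

definition transversal_indep :: "'i set \<Rightarrow> ('i \<Rightarrow> 'a set) \<Rightarrow> 'a set \<Rightarrow> bool" where
  "transversal_indep I A X \<longleftrightarrow> (\<exists>f. inj_on f X \<and> f ` X \<subseteq> I \<and> (\<forall>x\<in>X. x \<in> A (f x)))"

definition ground_E :: "nat \<Rightarrow> 'a set \<Rightarrow> (nat \<Rightarrow> 'a set) \<Rightarrow> 'a set" where
  "ground_E k C D = C \<union> (\<Union>i\<in>{1..3 * k * (2 * k - 1)}. D i)"

text \<open>The members of the family are indexed by a disjoint sum: the left summand indexes the
  sets \<open>D i\<close>, the right one the \<open>2 * k - 1\<close> copies of the ground set.\<close>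

definition indep_M :: "nat \<Rightarrow> 'a set \<Rightarrow> (nat \<Rightarrow> 'a set) \<Rightarrow> 'a set \<Rightarrow> bool" where
  "indep_M k C D =
     transversal_indep ({1..3 * k * (2 * k - 1)} <+> {1..2 * k - 1})
       (case_sum D (\<lambda>_::nat. ground_E k C D))"

text \<open>A position of the colouring game is the chronological list of all moves made so far; a
  move \<open>(x, c)\<close> gives element \<open>x\<close> the colour \<open>c\<close>. With \<open>n\<close> colours, the colours are
  \<open>0, \<dots>, n - 1\<close>. Alice moves in the positions of even length.\<close>

type_synonym 'a position = "('a \<times> nat) list"

definition colored :: "'a position \<Rightarrow> 'a set" where
  "colored h = fst ` set h"

definition color_class :: "'a position \<Rightarrow> nat \<Rightarrow> 'a set" where
  "color_class h c = {x. (x, c) \<in> set h}"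

definition legal_move ::
  "'a set \<Rightarrow> ('a set \<Rightarrow> bool) \<Rightarrow> nat \<Rightarrow> 'a position \<Rightarrow> 'a \<times> nat \<Rightarrow> bool" where
  "legal_move E indep n h m \<longleftrightarrow>
     fst m \<in> E - colored h \<and> snd m < n \<and> (\<forall>c<n. indep (color_class (h @ [m]) c))"

text \<open>The positions reachable when Alice plays according to the strategy \<open>\<sigma>\<close> and Bob makes
  arbitrary legal moves.\<close>

inductive play ::
  "'a set \<Rightarrow> ('a set \<Rightarrow> bool) \<Rightarrow> nat \<Rightarrow> ('a position \<Rightarrow> 'a \<times> nat) \<Rightarrow> 'a position \<Rightarrow> bool"
  for E indep n \<sigma> where
  start: "play E indep n \<sigma> []"
| alice: "play E indep n \<sigma> h \<Longrightarrow> even (length h) \<Longrightarrow> legal_move E indep n h (\<sigma> h) \<Longrightarrow>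
    play E indep n \<sigma> (h @ [\<sigma> h])"
| bob: "play E indep n \<sigma> h \<Longrightarrow> odd (length h) \<Longrightarrow> legal_move E indep n h m \<Longrightarrow>
    play E indep n \<sigma> (h @ [m])"

text \<open>A strategy wins if no play that follows it stops before \<open>E\<close> is completely coloured. As a
  play makes at most \<open>card E\<close> moves, for finite \<open>E\<close> every such play then ends with all of \<open>E\<close>
  coloured.\<close>

definition winning_strategy ::
  "'a set \<Rightarrow> ('a set \<Rightarrow> bool) \<Rightarrow> nat \<Rightarrow> ('a position \<Rightarrow> 'a \<times> nat) \<Rightarrow> bool" where
  "winning_strategy E indep n \<sigma> \<longleftrightarrow>
     (\<forall>h. play E indep n \<sigma> h \<longrightarrow> colored h = E \<or>
        (if even (length h) then legal_move E indep n h (\<sigma> h) else \<exists>m. legal_move E indep n h m))"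

definition game_chromatic_number :: "'a set \<Rightarrow> ('a set \<Rightarrow> bool) \<Rightarrow> nat" where
  "game_chromatic_number E indep = (LEAST n. \<exists>\<sigma>. winning_strategy E indep n \<sigma>)"

text \<open>The minimum is over a nonempty set for every finite loopless matroid.\<close>

lemma play_invariant:
  assumes "play E indep n \<sigma> h" and "indep {}"
  shows "colored h \<subseteq> E \<and> card (colored h) = length h \<and> (\<forall>c<n. indep (color_class h c))"
  using assms
proof (induction rule: play.induct)
  case start
  then show ?case by (simp add: colored_def color_class_def)
next
  case (alice h)
  then show ?case by (auto simp: legal_move_def colored_def)
next
  case (bob h m)
  then show ?case by (auto simp: legal_move_def colored_def)
qed

lemma winning_strategy_card_colors:
  assumes E: "finite E" and emp: "indep {}" and loopless: "\<And>x. x \<in> E \<Longrightarrow> indep {x}"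
  shows "\<exists>\<sigma>. winning_strategy E indep (card E) \<sigma>"
proof
  let ?\<sigma> = "\<lambda>h. SOME m. legal_move E indep (card E) h m"
  have "\<exists>m. legal_move E indep (card E) h m"
    if p: "play E indep (card E) ?\<sigma> h" and ne: "colored h \<noteq> E" for h
  proof -
    note inv = play_invariant[OF p emp]
    obtain x where x: "x \<in> E" "x \<notin> colored h" using inv ne by blast
    have "card (snd ` set h) \<le> length h"
      by (meson card_image_le card_length finite_set le_trans)
    also have "\<dots> < card E"
      using inv ne E by (metis psubset_card_mono psubsetI)
    finally have "\<not> {..<card E} \<subseteq> snd ` set h"
      using card_mono[of "snd ` set h" "{..<card E}"] by auto
    then obtain c where c: "c < card E" "c \<notin> snd ` set h" by auto
    have "color_class (h @ [(x, c)]) d = (if d = c then {x} else color_class h d)" for d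
      using c by (force simp: color_class_def)
    then have "legal_move E indep (card E) h (x, c)"
      using x c inv loopless by (simp add: legal_move_def)
    then show ?thesis ..
  qed
  then show "winning_strategy E indep (card E) ?\<sigma>"
    unfolding winning_strategy_def by (metis (no_types, lifting) someI_ex)
qed

end

theory Submission
  imports Defs
begin

text \<open>A set \<open>X\<close> is independent iff \<open>card X\<close> exceeds the number of \<open>D i\<close> that \<open>X\<close> meets by at most
  \<open>2 * k - 1\<close>. So each colour has capacity \<open>2 * k - 1\<close>: an element of \<open>C\<close> uses one unit, and so does
  every repetition of the colour inside some \<open>D i\<close>. With \<open>n < 2 * k - 1\<close> colours Bob wastes capacity
  until the rest does not suffice for \<open>C\<close>. Whenever possible, he repeats in some \<open>D i\<close> a colour that
  occurs there and is not exhausted. Otherwise he opens an untouched \<open>D i\<close> with a colour that is not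
  exhausted. When he opens with colour \<open>c\<close>, all sets opened with \<open>c\<close> before are fully coloured,
  so at most \<open>n\<close> opened sets are unfinished at any time. Each finished one has absorbed \<open>k\<close> moves,
  hence only a small part of Bob's moves are openings, which waste nothing.\<close>

section \<open>Independence in the transversal matroid as a cardinality bound\<close>

locale transversal_game =
  fixes k :: nat and C :: "'a set" and D :: "nat \<Rightarrow> 'a set"
  assumes k: "k > 2"
    and card_C: "card C = k * (2 * k - 1)"
    and card_D: "\<And>i. i \<in> {1..3 * k * (2 * k - 1)} \<Longrightarrow> card (D i) = k"
    and disj_D: "disjoint_family_on D {1..3 * k * (2 * k - 1)}"
    and disj_C: "\<And>i. i \<in> {1..3 * k * (2 * k - 1)} \<Longrightarrow> C \<inter> D i = {}"
begin

abbreviation "I \<equiv> {1..3 * k * (2 * k - 1)}"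
abbreviation "E \<equiv> ground_E k C D"
abbreviation "indep \<equiv> indep_M k C D"

definition hits :: "'a set \<Rightarrow> nat set" where
  "hits X = {i \<in> I. D i \<inter> X \<noteq> {}}"

lemma finite_C: "finite C"
  using card_C k by (intro card_ge_0_finite) simp

lemma finite_D: "i \<in> I \<Longrightarrow> finite (D i)"
  using card_D k by (intro card_ge_0_finite) simp

lemma finite_E: "finite E"
  unfolding ground_E_def using finite_C finite_D by blast

lemma C_subset_E: "C \<subseteq> E"
  by (auto simp: ground_E_def)

lemma D_subset_E: "i \<in> I \<Longrightarrow> D i \<subseteq> E"
  by (auto simp: ground_E_def)

lemma index_unique: "i \<in> I \<Longrightarrow> j \<in> I \<Longrightarrow> x \<in> D i \<Longrightarrow> x \<in> D j \<Longrightarrow> i = j"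
  using disj_D unfolding disjoint_family_on_def by blast

lemma not_in_C: "i \<in> I \<Longrightarrow> x \<in> D i \<Longrightarrow> x \<notin> C"
  using disj_C by blast

lemma finite_hits: "finite (hits X)"
  by (simp add: hits_def)

lemma hits_mono: "X \<subseteq> Y \<Longrightarrow> hits X \<subseteq> hits Y"
  by (auto simp: hits_def)

lemma hits_insert_C: "x \<in> C \<Longrightarrow> hits (insert x X) = hits X"
  unfolding hits_def using not_in_C by blast

lemma hits_insert_D: "i \<in> I \<Longrightarrow> x \<in> D i \<Longrightarrow> hits (insert x X) = insert i (hits X)"
  unfolding hits_def using index_unique by blast

text \<open>In a matching of \<open>X\<close>, every \<open>D i\<close> in use meets
  \<open>X\<close>, so at most \<open>card (hits X)\<close> elements go to such sets and the rest to
  copies of \<open>E\<close>. Conversely, one representative of each met \<open>D i\<close> is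
  matched to that \<open>D i\<close>, and the others fill the copies.\<close>

lemma indep_iff:
  assumes X: "X \<subseteq> E"
  shows "indep X \<longleftrightarrow> card X \<le> card (hits X) + (2 * k - 1)"
proof
  assume "indep X"
  then obtain f where f: "inj_on f X" "f ` X \<subseteq> I <+> {1..2 * k - 1}"
    "\<And>x. x \<in> X \<Longrightarrow> x \<in> case_sum D (\<lambda>_::nat. E) (f x)"
    by (auto simp: indep_M_def transversal_indep_def)
  have "f x \<in> hits X <+> {1..2 * k - 1}" if "x \<in> X" for x
    using f(2) f(3)[OF that] that by (auto simp: hits_def split: sum.splits)
  then have "card X \<le> card (hits X <+> {1..2 * k - 1})"
    using f(1) finite_hits by (intro card_inj_on_le[of f]) auto
  then show "card X \<le> card (hits X) + (2 * k - 1)"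
    using finite_hits by (simp add: card_Plus)
next
  have fin: "finite X" using X finite_E by (rule finite_subset)
  assume le: "card X \<le> card (hits X) + (2 * k - 1)"
  have "\<exists>g. \<forall>i\<in>hits X. g i \<in> D i \<inter> X"
    by (intro bchoice) (auto simp: hits_def)
  then obtain g where g: "\<And>i. i \<in> hits X \<Longrightarrow> g i \<in> D i \<inter> X" by blast
  have hI: "hits X \<subseteq> I" by (auto simp: hits_def)
  have inj: "inj_on g (hits X)"
  proof (rule inj_onI)
    fix i j assume ij: "i \<in> hits X" "j \<in> hits X" "g i = g j"
    then have "g i \<in> D i" "g i \<in> D j" using g[OF ij(1)] g[OF ij(2)] by auto
    then show "i = j" using index_unique ij(1,2) hI by blast
  qed
  let ?S = "g ` hits X"
  have "card (X - ?S) = card X - card (hits X)"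
    using g fin finite_hits by (subst card_Diff_subset) (auto simp: card_image inj)
  then have "card (X - ?S) \<le> card {1..2 * k - 1}" using le by simp
  then obtain e where e: "inj_on e (X - ?S)" "e ` (X - ?S) \<subseteq> {1..2 * k - 1}"
    using fin by (meson card_le_inj finite_Diff finite_atLeastAtMost)
  define f where "f x = (if x \<in> ?S then Inl (the_inv_into (hits X) g x) else Inr (e x))" for x
  have inv: "the_inv_into (hits X) g (g i) = i" if "i \<in> hits X" for i
    using inj that by (rule the_inv_into_f_f)
  have "inj_on f X"
    using e(1) by (auto simp: inj_on_def f_def inv)
  moreover have "f ` X \<subseteq> I <+> {1..2 * k - 1}"
    using e(2) hI by (auto simp: f_def inv)
  moreover have "x \<in> case_sum D (\<lambda>_::nat. E) (f x)" if "x \<in> X" for x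
    using that X g by (auto simp: f_def inv)
  ultimately show "indep X"
    unfolding indep_M_def transversal_indep_def by blast
qed

lemma indep_empty: "indep {}"
  by (simp add: indep_iff)

lemma indep_singleton: "x \<in> E \<Longrightarrow> indep {x}"
  using k by (subst indep_iff) auto

end

section \<open>Capacity used and wasted when Alice wins with too few colours\<close>

locale winning_game = transversal_game k C D
  for k :: nat and C :: "'a set" and D +
  fixes n :: nat and \<sigma>
  assumes win: "winning_strategy (ground_E k C D) (indep_M k C D) n \<sigma>"
    and n: "n < 2 * k - 1"
begin

abbreviation "plays \<equiv> play E indep n \<sigma>"

abbreviation cpart :: "'a position \<Rightarrow> nat" where
  "cpart h \<equiv> card (C \<inter> colored h)"

text \<open>In a play, \<open>length h - npairs h\<close> is the capacity used so far:
  \<open>indep_iff\<close>, summed over the colours, bounds it by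
  \<open>n * (2 * k - 1)\<close>.\<close>

definition npairs :: "'a position \<Rightarrow> nat" where
  "npairs h = (\<Sum>c<n. card (hits (color_class h c)))"

lemma color_class_snoc:
  "color_class (h @ [m]) c = (if c = snd m then insert (fst m) (color_class h c) else color_class h c)"
  by (cases m) (auto simp: color_class_def)

lemma colored_snoc: "colored (h @ [m]) = insert (fst m) (colored h)"
  by (auto simp: colored_def)

lemma color_class_subset: "color_class h c \<subseteq> colored h"
  by (force simp: color_class_def colored_def)

lemma plays_invariant:
  assumes "plays h"
  shows "colored h \<subseteq> E" "card (colored h) = length h" "c < n \<Longrightarrow> indep (color_class h c)"
    "finite (colored h)"
  using play_invariant[OF assms indep_empty] finite_subset[OF _ finite_E] by auto

lemma class_finite: "plays h \<Longrightarrow> finite (color_class h c)"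
  by (rule finite_subset[OF color_class_subset plays_invariant(4)])

lemma class_E: "plays h \<Longrightarrow> color_class h c \<subseteq> E"
  by (rule subset_trans[OF color_class_subset plays_invariant(1)])

text \<open>The offsets \<open>e\<close> and \<open>e'\<close> on both sides avoid subtraction of
  natural numbers.\<close>

lemma sum_update:
  fixes f g :: "nat \<Rightarrow> nat"
  assumes "d < n" "\<And>c. c < n \<Longrightarrow> c \<noteq> d \<Longrightarrow> f c = g c" "f d + e' = g d + e"
  shows "(\<Sum>c<n. f c) + e' = (\<Sum>c<n. g c) + e"
proof -
  have "(\<Sum>c<n. f c) = f d + sum f ({..<n} - {d})" "(\<Sum>c<n. g c) = g d + sum g ({..<n} - {d})"
    using assms(1) by (auto intro: sum.remove)
  moreover have "sum f ({..<n} - {d}) = sum g ({..<n} - {d})"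
    using assms(2) by (intro sum.cong) auto
  ultimately show ?thesis using assms(3) by simp
qed

lemma sum_class_snoc:
  assumes p: "plays h" and m: "legal_move E indep n h m"
    and IH: "(\<Sum>c<n. card (color_class h c)) = length h"
  shows "(\<Sum>c<n. card (color_class (h @ [m]) c)) = length (h @ [m])"
proof -
  have "fst m \<notin> color_class h (snd m)" and "snd m < n"
    using m color_class_subset[of h "snd m"] by (auto simp: legal_move_def)
  then have "(\<Sum>c<n. card (color_class (h @ [m]) c)) + 0 = (\<Sum>c<n. card (color_class h c)) + 1"
    using p by (intro sum_update[of "snd m"]) (auto simp: color_class_snoc class_finite)
  then show ?thesis using IH by simp
qed

lemma sum_class: "plays h \<Longrightarrow> (\<Sum>c<n. card (color_class h c)) = length h"
proof (induction rule: play.induct)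
  case start
  then show ?case by (simp add: color_class_def)
next
  case (alice h)
  then show ?case using sum_class_snoc by blast
next
  case (bob h m)
  then show ?case using sum_class_snoc by blast
qed

lemma length_le_npairs:
  assumes "plays h"
  shows "length h \<le> npairs h + n * (2 * k - 1)"
proof -
  have "(\<Sum>c<n. card (color_class h c)) \<le> (\<Sum>c<n. card (hits (color_class h c)) + (2 * k - 1))"
    using plays_invariant(3)[OF assms] indep_iff[OF class_E[OF assms]] by (intro sum_mono) simp
  then show ?thesis
    by (simp add: sum_class[OF assms] npairs_def sum.distrib)
qed

lemma npairs_C:
  assumes "legal_move E indep n h m" "fst m \<in> C"
  shows "npairs (h @ [m]) = npairs h"
  unfolding npairs_def using assms by (intro sum.cong) (auto simp: color_class_snoc hits_insert_C)

lemma npairs_D: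
  assumes "legal_move E indep n h m" "i \<in> I" "fst m \<in> D i"
  shows "npairs (h @ [m]) = npairs h + (if i \<in> hits (color_class h (snd m)) then 0 else 1)"
proof -
  have "npairs (h @ [m]) + 0 = npairs h + (if i \<in> hits (color_class h (snd m)) then 0 else 1)"
    unfolding npairs_def
    using assms finite_hits by (intro sum_update[of "snd m"])
      (auto simp: color_class_snoc hits_insert_D[of i] legal_move_def insert_absorb)
  then show ?thesis by simp
qed

lemma cpart_snoc:
  assumes "plays h" "legal_move E indep n h m"
  shows "cpart (h @ [m]) = cpart h + (if fst m \<in> C then 1 else 0)"
  using assms plays_invariant(4)[OF assms(1)] by (auto simp: colored_snoc legal_move_def)

lemma move_cases:
  assumes "legal_move E indep n h m"
  obtains "fst m \<in> C" | i where "i \<in> I" "fst m \<in> D i" "fst m \<notin> C"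
  using assms not_in_C unfolding legal_move_def ground_E_def by blast

text \<open>Since a move adds one to the length, the capacity wasted on the \<open>D i\<close>,
  \<open>length h - npairs h - cpart h\<close>, cannot decrease. A move in \<open>C\<close> raises
  only \<open>cpart\<close>, a move in some \<open>D i\<close> at most
  \<open>npairs\<close>.\<close>

lemma waste_mono:
  assumes "plays h" and m: "legal_move E indep n h m"
  shows "npairs (h @ [m]) + cpart (h @ [m]) \<le> npairs h + cpart h + 1"
  using m
proof (cases rule: move_cases)
  case 1
  then show ?thesis by (simp add: npairs_C[OF m] cpart_snoc[OF assms])
next
  case (2 i)
  then show ?thesis using npairs_D[OF m, of i] by (simp add: cpart_snoc[OF assms])
qed

lemma move_exists:
  assumes "plays h" "colored h \<noteq> E"
  shows "\<exists>m. legal_move E indep n h m \<and> plays (h @ [m])"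
proof (cases "even (length h)")
  case True
  then have "legal_move E indep n h (\<sigma> h)"
    using win assms unfolding winning_strategy_def by auto
  then show ?thesis using play.alice[OF assms(1) True] by blast
next
  case False
  then obtain m where "legal_move E indep n h m"
    using win assms unfolding winning_strategy_def by (metis (full_types))
  then show ?thesis using play.bob[OF assms(1) False] by blast
qed

text \<open>Every play can be continued until all of \<open>C\<close> is coloured, and the capacity wasted on the
  \<open>D i\<close> never decreases. So the wasted capacity always leaves room for all of \<open>C\<close>.\<close>

lemma waste_bound:
  assumes "plays h"
  shows "length h + card C \<le> npairs h + cpart h + n * (2 * k - 1)"
  using assms
proof (induction "card E - length h" arbitrary: h rule: less_induct)
  case less
  show ?case
  proof (cases "colored h = E")
    case True
    then have "cpart h = card C" using C_subset_E by (simp add: Int_absorb2)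
    then show ?thesis using length_le_npairs[OF less.prems] by simp
  next
    case False
    then obtain m where m: "legal_move E indep n h m" "plays (h @ [m])"
      using move_exists less.prems by blast
    have "length h < card E"
      using plays_invariant[OF less.prems] False finite_E by (metis psubset_card_mono psubsetI)
    then have "card E - length (h @ [m]) < card E - length h" by simp
    from less.hyps[OF this m(2)] show ?thesis
      using waste_mono[OF less.prems m(1)] by simp
  qed
qed

text \<open>Stricter than what legality requires: a colour without room still accepts an element of
  a \<open>D i\<close> that it has not met.\<close>

definition has_room :: "'a position \<Rightarrow> nat \<Rightarrow> bool" where
  "has_room h c \<longleftrightarrow> c < n \<and> card (color_class h c) < card (hits (color_class h c)) + (2 * k - 1)"

text \<open>If every colour were exhausted, the used capacity would reach
  \<open>n * (2 * k - 1)\<close>, and \<open>waste_bound\<close> would force all of \<open>C\<close>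
  to be coloured.\<close>

lemma room_exists:
  assumes p: "plays h" and "cpart h < card C"
  shows "\<exists>c. has_room h c"
proof (rule ccontr)
  assume "\<not> ?thesis"
  then have "card (hits (color_class h c)) + (2 * k - 1) \<le> card (color_class h c)" if "c < n" for c
    using that by (meson has_room_def not_less)
  then have "(\<Sum>c<n. card (hits (color_class h c)) + (2 * k - 1)) \<le> (\<Sum>c<n. card (color_class h c))"
    by (intro sum_mono) blast
  then have "npairs h + n * (2 * k - 1) \<le> length h"
    by (simp add: sum_class[OF p] npairs_def sum.distrib)
  then show False using waste_bound[OF p] assms(2) by simp
qed

lemma legal_with_room:
  assumes p: "plays h" and room: "has_room h c" and x: "x \<in> E - colored h"
  shows "legal_move E indep n h (x, c)"
proof -
  have "card (insert x (color_class h c)) \<le> Suc (card (color_class h c))"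
    by (rule card_insert_le_m1) auto
  also have "\<dots> \<le> card (hits (color_class h c)) + (2 * k - 1)"
    using room by (simp add: has_room_def)
  also have "\<dots> \<le> card (hits (insert x (color_class h c))) + (2 * k - 1)"
    by (simp add: card_mono finite_hits hits_mono subset_insertI)
  finally have "indep (insert x (color_class h c))"
    using x class_E[OF p] by (subst indep_iff) auto
  then show ?thesis
    using room x plays_invariant(3)[OF p]
    by (auto simp: legal_move_def has_room_def color_class_snoc)
qed

section \<open>Bob's invariant and the estimates that keep his strategy going\<close>

text \<open>\<open>W\<close> collects the pairs \<open>(i, c)\<close> for which Bob opened \<open>D i\<close> with colour \<open>c\<close>.\<close>

definition bob_inv :: "nat \<Rightarrow> 'a position \<Rightarrow> (nat \<times> nat) set \<Rightarrow> bool" where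
  "bob_inv b h W \<longleftrightarrow> plays h \<and> cpart h \<le> b \<and> npairs h + cpart h \<le> card W + b \<and>
     inj_on fst W \<and> inj_on snd {w \<in> W. \<not> D (fst w) \<subseteq> colored h} \<and>
     (\<forall>(i, c)\<in>W. c < n \<and> i \<in> hits (color_class h c))"

lemma bob_inv_finite: "bob_inv b h W \<Longrightarrow> finite W"
proof -
  assume "bob_inv b h W"
  then have "W \<subseteq> I \<times> {..<n}" by (auto simp: bob_inv_def hits_def)
  then show "finite W" by (rule finite_subset) simp
qed

text \<open>Here \<open>q\<close> counts the pairs in \<open>W\<close> whose set is fully coloured.
  The other pairs have distinct colours, so there are at most \<open>n\<close>. Each finished set
  holds \<open>k\<close> coloured elements, and every other touched \<open>D i\<close> at least
  one.\<close>

lemma finished_count: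
  assumes "bob_inv b h W"
  obtains q where "card W \<le> n + q" "card (hits (colored h)) + (k - 1) * q + cpart h \<le> length h"
    "k * q + cpart h \<le> length h"
proof -
  let ?F = "{w \<in> W. D (fst w) \<subseteq> colored h}" and ?U = "{w \<in> W. \<not> D (fst w) \<subseteq> colored h}"
  let ?G = "fst ` ?F" and ?T = "hits (colored h)"
  note inv = assms[unfolded bob_inv_def]
  have p: "plays h" using inv by blast
  have "card ?U \<le> card {..<n}"
    using inv by (intro card_inj_on_le[of snd]) auto
  moreover have "card W = card (?F \<union> ?U)" by (rule arg_cong[of _ _ card]) auto
  ultimately have 1: "card W \<le> n + card ?F"
    using card_Un_le[of ?F ?U] by simp
  have cG: "card ?G = card ?F"
    using inv by (intro card_image) (auto intro: inj_on_subset)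
  have GT: "?G \<subseteq> ?T"
    using inv color_class_subset by (fastforce simp: hits_def)
  have finT: "finite ?T" by (rule finite_hits)
  have TI: "?T \<subseteq> I" by (auto simp: hits_def)
  have disj: "(C \<inter> colored h) \<inter> (\<Union>i\<in>?T. D i \<inter> colored h) = {}"
    using not_in_C TI by blast
  have "card (\<Union>i\<in>?T. D i \<inter> colored h) = (\<Sum>i\<in>?T. card (D i \<inter> colored h))"
    using finT TI finite_D index_unique by (intro card_UN_disjoint) blast+
  then have "cpart h + (\<Sum>i\<in>?T. card (D i \<inter> colored h))
      = card ((C \<inter> colored h) \<union> (\<Union>i\<in>?T. D i \<inter> colored h))"
    using disj finT plays_invariant(4)[OF p] by (subst card_Un_disjoint) auto
  also have "\<dots> \<le> card (colored h)"
    using plays_invariant(4)[OF p] by (intro card_mono) auto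
  finally have 2: "cpart h + (\<Sum>i\<in>?T. card (D i \<inter> colored h)) \<le> length h"
    using plays_invariant(2)[OF p] by simp
  have "(\<Sum>i\<in>?G. card (D i \<inter> colored h)) = (\<Sum>i\<in>?G. k)"
  proof (rule sum.cong)
    fix i assume i: "i \<in> ?G"
    then have "D i \<inter> colored h = D i" by auto
    moreover have "i \<in> I" using i GT TI by blast
    ultimately show "card (D i \<inter> colored h) = k" using card_D by simp
  qed simp
  moreover have "(\<Sum>i\<in>?T - ?G. 1) \<le> (\<Sum>i\<in>?T - ?G. card (D i \<inter> colored h))"
  proof (rule sum_mono)
    fix i assume "i \<in> ?T - ?G"
    then show "1 \<le> card (D i \<inter> colored h)"
      using plays_invariant(4)[OF p] by (auto simp: hits_def Suc_le_eq card_gt_0_iff)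
  qed
  moreover have "(\<Sum>i\<in>?T. card (D i \<inter> colored h))
      = (\<Sum>i\<in>?T - ?G. card (D i \<inter> colored h)) + (\<Sum>i\<in>?G. card (D i \<inter> colored h))"
    using GT finT by (rule sum.subset_diff)
  ultimately have 3: "k * card ?F + card (?T - ?G) \<le> (\<Sum>i\<in>?T. card (D i \<inter> colored h))"
    by (simp add: cG)
  have 4: "card ?T = card (?T - ?G) + card ?F"
    using GT finT card_mono[OF finT GT] by (simp add: cG card_Diff_subset finite_subset)
  have 5: "k * card ?F = (k - 1) * card ?F + card ?F"
    using k by (cases k) auto
  show thesis
    using that[OF 1] 2 3 4 5 by linarith
qed

text \<open>The position is the one after Alice's move number \<open>b + 1\<close>. The invariant
  charges \<open>npairs h + cpart h\<close> to her moves and Bob's openings, so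
  \<open>waste_bound\<close> limits the length of play by the number of openings.\<close>

lemma bob_balance:
  assumes inv: "bob_inv (Suc b) h W" and len: "length h = 2 * b + 1"
  shows "b + card C \<le> card W + n * (2 * k - 1)"
  using waste_bound[of h] inv len by (simp add: bob_inv_def)

text \<open>With \<open>k = j + 3\<close> all bounds become polynomials in \<open>j\<close> with
  nonnegative coefficients, so linear arithmetic can treat \<open>j * j\<close> as an atom.\<close>

lemma size_bounds:
  obtains j where "k = j + 3" "card C = 2 * j * j + 11 * j + 15" "n \<le> 2 * j + 4"
    "n * (2 * k - 1) \<le> 4 * j * j + 18 * j + 20"
proof -
  define j where "j = k - 3"
  then have j: "k = j + 3" using k by simp
  have n': "n \<le> 2 * j + 4" using n j by simp
  then have "n * (2 * k - 1) \<le> (2 * j + 4) * (2 * k - 1)" by (rule mult_right_mono) simp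
  then show thesis using that[OF j] n' card_C by (simp add: j algebra_simps)
qed

lemma C_unfinished:
  assumes inv: "bob_inv (Suc b) h W" and len: "length h = 2 * b + 1"
  shows "cpart h < card C"
proof (rule ccontr)
  assume "\<not> ?thesis"
  then have C: "card C \<le> cpart h" by simp
  obtain j where j: "k = j + 3" "card C = 2 * j * j + 11 * j + 15" "n \<le> 2 * j + 4"
    "n * (2 * k - 1) \<le> 4 * j * j + 18 * j + 20" by (rule size_bounds)
  obtain q where q: "card W \<le> n + q" "k * q + cpart h \<le> length h"
    using finished_count[OF inv] by metis
  have "cpart h \<le> Suc b" using inv by (simp add: bob_inv_def)
  \<comment> \<open>Now \<open>card C\<close> is at most \<open>b + 1\<close>, so the balance can
    only hold if many sets are finished.\<close>
  then have "2 * j + 5 \<le> q" using bob_balance[OF assms] C q j by linarith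
  then have "(j + 1) * (2 * j + 5) \<le> (j + 1) * q" by (rule mult_left_mono) simp
  \<comment> \<open>The part \<open>2 * q\<close> cancels against the doubled balance. What remains
    gives \<open>(j + 1) * q\<close> at most \<open>2 * j * j + 7 * j + 4\<close>, one less than
    \<open>(j + 1) * (2 * j + 5)\<close>.\<close>
  moreover have "k * q = (j + 1) * q + 2 * q" by (simp add: j algebra_simps)
  ultimately show False
    using bob_balance[OF assms] C q len j by (simp add: algebra_simps)
qed

text \<open>There are \<open>3 * card C\<close> sets \<open>D i\<close>. Touching all of them would
  take more moves than the balance allows, even with every finished set credited as an
  opening.\<close>

lemma fresh_exists:
  assumes inv: "bob_inv (Suc b) h W" and len: "length h = 2 * b + 1"
  shows "\<exists>i\<in>I. D i \<inter> colored h = {}"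
proof (rule ccontr)
  assume "\<not> ?thesis"
  then have "hits (colored h) = I" by (auto simp: hits_def)
  then have T: "card (hits (colored h)) = 3 * card C" by (simp add: card_C)
  obtain j where j: "k = j + 3" "card C = 2 * j * j + 11 * j + 15" "n \<le> 2 * j + 4"
    "n * (2 * k - 1) \<le> 4 * j * j + 18 * j + 20" by (rule size_bounds)
  obtain q where q: "card W \<le> n + q"
    "card (hits (colored h)) + (k - 1) * q + cpart h \<le> length h"
    using finished_count[OF inv] by metis
  have "(k - 1) * q = j * q + 2 * q" by (simp add: j algebra_simps)
  then show False
    using bob_balance[OF assms] q len T j by simp
qed

section \<open>The rounds of play and the contradiction\<close>

lemma bob_inv_snoc:
  assumes inv: "bob_inv b h W" and p: "plays (h @ [m])"
    and "cpart (h @ [m]) \<le> b'" "npairs (h @ [m]) + cpart (h @ [m]) \<le> card W + b'"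
  shows "bob_inv b' (h @ [m]) W"
proof -
  have "inj_on snd {w \<in> W. \<not> D (fst w) \<subseteq> colored (h @ [m])}"
    using inv unfolding bob_inv_def
    by (elim conjE, elim inj_on_subset) (auto simp: colored_snoc)
  moreover have "hits (color_class h c) \<subseteq> hits (color_class (h @ [m]) c)" for c
    by (rule hits_mono) (auto simp: color_class_snoc)
  ultimately show ?thesis
    using assms unfolding bob_inv_def by fast
qed

text \<open>Bob's move leaves the budget \<open>Suc b\<close> unchanged: a repetition keeps
  \<open>npairs\<close> and \<open>cpart\<close>, and an opening raises \<open>npairs\<close> and
  \<open>card W\<close> by one each. He never colours \<open>C\<close>, so Alice still has a move
  afterwards.\<close>

lemma bob_round:
  assumes inv: "bob_inv (Suc b) h W" and len: "length h = 2 * b + 1"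
  shows "\<exists>m W'. bob_inv (Suc b) (h @ [m]) W' \<and> cpart (h @ [m]) < card C"
proof -
  have p: "plays h" and odd: "odd (length h)" using inv len by (auto simp: bob_inv_def)
  have unfin: "cpart h < card C" using C_unfinished[OF assms] .
  show ?thesis
  proof (cases "\<exists>i\<in>I. \<exists>x\<in>D i - colored h. \<exists>c. has_room h c \<and> i \<in> hits (color_class h c)")
    case True
    then obtain i x c where *: "i \<in> I" "x \<in> D i - colored h" "has_room h c"
      "i \<in> hits (color_class h c)" by blast
    have m: "legal_move E indep n h (x, c)"
      using legal_with_room[OF p *(3)] * D_subset_E by blast
    have "cpart (h @ [(x, c)]) = cpart h"
      using cpart_snoc[OF p m] not_in_C * by auto
    moreover have "npairs (h @ [(x, c)]) = npairs h"
      using npairs_D[OF m] * by auto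
    ultimately have "bob_inv (Suc b) (h @ [(x, c)]) W"
      using inv play.bob[OF p odd m] by (intro bob_inv_snoc) (auto simp: bob_inv_def)
    then show ?thesis using unfin \<open>cpart (h @ [(x, c)]) = cpart h\<close> by metis
  next
    case False
    obtain c where c: "has_room h c" using room_exists[OF p unfin] by blast
    obtain i where i: "i \<in> I" "D i \<inter> colored h = {}" using fresh_exists[OF assms] by blast
    have "D i \<noteq> {}" using card_D[OF i(1)] k by auto
    then obtain x where x: "x \<in> D i" by blast
    have m: "legal_move E indep n h (x, c)"
      using legal_with_room[OF p c] x i D_subset_E by blast
    let ?h = "h @ [(x, c)]" and ?W = "insert (i, c) W"
    have ihit: "i \<notin> hits (color_class h d)" for d
      using i(2) color_class_subset[of h d] by (auto simp: hits_def)
    have cp: "cpart ?h = cpart h"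
      using cpart_snoc[OF p m] not_in_C i x by auto
    have np: "npairs ?h = npairs h + 1"
      using npairs_D[OF m i(1)] x ihit by auto
    have new: "i \<notin> fst ` W"
      using inv ihit by (fastforce simp: bob_inv_def)
    then have cW: "card ?W = card W + 1"
      using bob_inv_finite[OF inv] by (subst card_insert_disjoint) force+
    \<comment> \<open>As no repetition is possible, a colour with room leaves no uncoloured element
      in any \<open>D j\<close> where it occurs. Hence the new pair shares its colour with no
      unfinished pair.\<close>
    have finished: "D j \<subseteq> colored h" if "(j, c) \<in> W" for j
    proof -
      have "j \<in> hits (color_class h c)" "j \<in> I"
        using inv that by (auto simp: bob_inv_def hits_def)
      then show ?thesis using False c by blast
    qed
    have sub: "{w \<in> ?W. \<not> D (fst w) \<subseteq> colored ?h}
        \<subseteq> insert (i, c) {w \<in> W. \<not> D (fst w) \<subseteq> colored h}"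
      by (auto simp: colored_snoc)
    have "inj_on snd (insert (i, c) {w \<in> W. \<not> D (fst w) \<subseteq> colored h})"
      using inv finished unfolding inj_on_insert bob_inv_def by force
    then have inj: "inj_on snd {w \<in> ?W. \<not> D (fst w) \<subseteq> colored ?h}"
      using sub by (rule inj_on_subset)
    have hm: "hits (color_class h d) \<subseteq> hits (color_class ?h d)" for d
      by (rule hits_mono) (auto simp: color_class_snoc)
    have "i \<in> hits (color_class ?h c)"
      using i x by (auto simp: hits_def color_class_snoc)
    then have "\<forall>(j, d)\<in>?W. d < n \<and> j \<in> hits (color_class ?h d)"
      using inv c hm unfolding bob_inv_def has_room_def by fast
    moreover have "inj_on fst ?W"
      using inv new by (auto simp: bob_inv_def)
    ultimately have "bob_inv (Suc b) ?h ?W"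
      using inv play.bob[OF p odd m] inj unfolding bob_inv_def cp np cW by simp
    then show ?thesis using unfin cp by metis
  qed
qed

text \<open>By \<open>waste_mono\<close>, whatever Alice plays costs at most one unit, so
  \<open>b\<close> counts her moves.\<close>

lemma alice_round:
  assumes inv: "bob_inv b h W" and "even (length h)" "cpart h < card C"
  shows "\<exists>m. bob_inv (Suc b) (h @ [m]) W"
proof -
  have p: "plays h" using inv by (simp add: bob_inv_def)
  have "colored h \<noteq> E" using assms(3) C_subset_E by (auto simp: Int_absorb2)
  then obtain m where m: "legal_move E indep n h m" "plays (h @ [m])"
    using move_exists[OF p] by blast
  have "bob_inv (Suc b) (h @ [m]) W"
    using inv m waste_mono[OF p m(1)] cpart_snoc[OF p m(1)]
    by (intro bob_inv_snoc) (auto simp: bob_inv_def)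
  then show ?thesis ..
qed

lemma endless_play: "\<exists>h W. bob_inv (Suc b) h W \<and> length h = 2 * b + 1"
proof (induction b)
  case 0
  have "bob_inv 0 [] {}"
    by (auto simp: bob_inv_def colored_def npairs_def color_class_def hits_def intro: play.start)
  moreover have "cpart [] < card C" using card_C k by (simp add: colored_def)
  ultimately obtain m where "bob_inv (Suc 0) ([] @ [m]) {}"
    using alice_round[of 0 "[]" "{}"] by auto
  then show ?case by (intro exI[of _ "[m]"] exI[of _ "{}"]) simp
next
  case (Suc b)
  then obtain h W where h: "bob_inv (Suc b) h W" "length h = 2 * b + 1" by blast
  obtain m W' where m: "bob_inv (Suc b) (h @ [m]) W'" "cpart (h @ [m]) < card C"
    using bob_round[OF h] by blast
  obtain m' where "bob_inv (Suc (Suc b)) ((h @ [m]) @ [m']) W'"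
    using alice_round[OF m(1)] m(2) h(2) by auto
  then show ?case using h(2) by (intro exI[of _ "(h @ [m]) @ [m']"] exI[of _ W']) simp
qed

text \<open>Each move colours a new element, so no play is longer than
  \<open>card E\<close>.\<close>

lemma contradiction: False
proof -
  obtain h W where h: "bob_inv (Suc (card E)) h W" "length h = 2 * card E + 1"
    using endless_play by blast
  then have "plays h" by (simp add: bob_inv_def)
  then have "length h \<le> card E"
    using plays_invariant(1,2) finite_E card_mono by metis
  then show False using h(2) by simp
qed

end

theorem theorem13:
  fixes k :: nat and C :: "'a set" and D :: "nat \<Rightarrow> 'a set"
  assumes "k > 2"
    and "card C = k * (2 * k - 1)"
    and "\<And>i. i \<in> {1..3 * k * (2 * k - 1)} \<Longrightarrow> card (D i) = k"
    and "disjoint_family_on D {1..3 * k * (2 * k - 1)}"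
    and "\<And>i. i \<in> {1..3 * k * (2 * k - 1)} \<Longrightarrow> C \<inter> D i = {}"
  shows "game_chromatic_number (ground_E k C D) (indep_M k C D) \<ge> 2 * k - 1"
proof (rule ccontr)
  let ?n = "game_chromatic_number (ground_E k C D) (indep_M k C D)"
  assume "\<not> ?thesis"
  then have n: "?n < 2 * k - 1" by simp
  interpret transversal_game k C D by unfold_locales (use assms in auto)
  \<comment> \<open>\<open>LEAST\<close> is attained only if some number of colours suffices;
    \<open>card E\<close> colours do.\<close>
  have "\<exists>n \<sigma>. winning_strategy E indep n \<sigma>"
    using winning_strategy_card_colors[OF finite_E indep_empty indep_singleton] by blast
  then have "\<exists>\<sigma>. winning_strategy E indep ?n \<sigma>"
    unfolding game_chromatic_number_def by (rule LeastI_ex)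
  then obtain \<sigma> where "winning_strategy E indep ?n \<sigma>" ..
  then interpret winning_game k C D ?n \<sigma> using n by unfold_locales
  show False by (rule contradiction)
qed

end
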